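(* Fix $q\in(0,1]$. Suppose that the number of rating categories $m=m(n)\ge 2$ satisfies $m=o\bigl((\tfrac{n}{\ln n})^{1/4}\bigr)$ as the sample size $n\to\infty$. Then the Polarizing-Averaging Aggregator is $O\bigl(m^2\sqrt{\ln n/n}\bigr)$-optimal: there exist constants $C,N$ such that for all $n\ge N$ and every aggregator $f$ (a real-valued function of the observed histogram $(n_1,\dots,n_m)$), $$\max_{\boldsymbol p,\boldsymbol g} R(f^{PAA},\boldsymbol p,\boldsymbol g)\ \le\ \max_{\boldsymbol p,\boldsymbol g} R(f,\boldsymbol p,\boldsymbol g)+C\,m^2\sqrt{\frac{\ln n}{n}},$$ where the maxima are over all probability vectors $\boldsymbol p$ on $\{1,\dots,m\}$ and all $\boldsymbol g\in[q,1]^m$.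
   Context: There are $n$ raters. The true ratings $x_1,\dots,x_n\in\{1,\dots,m\}$ are i.i.d. with distribution $\boldsymbol p=(p_1,\dots,p_m)$ and mean $\mu=\sum_r r p_r$. Independently across raters, rater $i$ reports her rating with probability $g_{x_i}$, where $\boldsymbol g=(g_1,\dots,g_m)\in[q,1]^m$: the observation is $\hat x_i=x_i$ with probability $g_{x_i}$ and $\hat x_i=0$ (unobserved) otherwise. The aggregator sees the histogram of observed ratings $(n_1,\dots,n_m)$, $n_r=|\{i:\hat x_i=r\}|$. The regret of an aggregator $f$ is $$R(f,\boldsymbol p,\boldsymbol g)=\mathbb{E}\Bigl[(f(\hat{\boldsymbol x})-\mu)^2-\Bigl(\tfrac1n\sum_{i=1}^n x_i-\mu\Bigr)^2\Bigr].$$ The Polarizing-Averaging Aggregator (PAA) is applied to the empirical distribution $\hat p_r=n_r/\sum_j n_j$ of observed ratings: $f^{PAA}(\hat{\boldsymbol p})=\frac{u(\hat{\boldsymbol p})+l(\hat{\boldsymbol p})}{2}$, where $$l(\hat{\boldsymbol p})=\frac{\sum_{r=1}^{k_1}r\hat p_r+q\sum_{r=k_1+1}^{m}r\hat p_r}{\sum_{r=1}^{k_1}\hat p_r+q\sum_{r=k_1+1}^{m}\hat p_r},\qquad u(\hat{\boldsymbol p})=\frac{q\sum_{r=1}^{k_2}r\hat p_r+\sum_{r=k_2+1}^{m}r\hat p_r}{q\sum_{r=1}^{k_2}\hat p_r+\sum_{r=k_2+1}^{m}\hat p_r},$$ $k_1=k_1(\hat{\boldsymbol p})$ is the largest $k\in\{1,\dots,m\}$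 such that $\sum_{r=1}^{k-1}(r-k)\hat p_r+q\sum_{r=k+1}^{m}(r-k)\hat p_r\ge 0$, and $k_2=k_2(\hat{\boldsymbol p})$ is the largest $k\in\{1,\dots,m\}$ such that $q\sum_{r=1}^{k-1}(r-k)\hat p_r+\sum_{r=k+1}^{m}(r-k)\hat p_r\ge 0$. If no rating is observed ($\sum_j n_j=0$), $f^{PAA}$ outputs an arbitrary fixed value in $[1,m]$. *)

theory Defs
  imports "HOL-Probability.Probability" "HOL-Library.Landau_Symbols"
begin

text \<open>
  Ratings are the naturals \<open>1, \<dots>, m\<close>, and \<open>0\<close> encodes ``not observed''.  A probability vector on
  \<open>{1..m}\<close> is a \<open>nat pmf\<close> supported in \<open>{1..m}\<close>.
\<close>

definition rater_pmf :: "nat pmf \<Rightarrow> (nat \<Rightarrow> real) \<Rightarrow> (nat \<times> nat) pmf" where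
  "rater_pmf p g = do {
     x \<leftarrow> p;
     b \<leftarrow> bernoulli_pmf (g x);
     return_pmf (x, if b then x else 0)
   }"

text \<open>A sample \<open>\<omega>\<close> gives rater \<open>i\<close>'s true rating \<open>fst (\<omega> i)\<close> and observed rating \<open>snd (\<omega> i)\<close>.\<close>

definition sample_pmf :: "nat \<Rightarrow> nat pmf \<Rightarrow> (nat \<Rightarrow> real) \<Rightarrow> (nat \<Rightarrow> nat \<times> nat) pmf" where
  "sample_pmf n p g = Pi_pmf {1..n} (0, 0) (\<lambda>_. rater_pmf p g)"

text \<open>Histograms are extended by \<open>0\<close> outside \<open>{1..m}\<close>, so they carry exactly \<open>(n\<^sub>1, \<dots>, n\<^sub>m)\<close>.\<close>

definition histogram :: "nat \<Rightarrow> nat \<Rightarrow> (nat \<Rightarrow> nat) \<Rightarrow> nat \<Rightarrow> nat" where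
  "histogram n m xh = (\<lambda>r. if r \<in> {1..m} then card {i \<in> {1..n}. xh i = r} else 0)"

type_synonym aggregator = "(nat \<Rightarrow> nat) \<Rightarrow> real"

definition mean_rating :: "nat \<Rightarrow> nat pmf \<Rightarrow> real" where
  "mean_rating m p = (\<Sum>r=1..m. real r * pmf p r)"

definition regret ::
  "nat \<Rightarrow> nat \<Rightarrow> aggregator \<Rightarrow> nat pmf \<Rightarrow> (nat \<Rightarrow> real) \<Rightarrow> real" where
  "regret n m f p g = measure_pmf.expectation (sample_pmf n p g)
     (\<lambda>\<omega>. (f (histogram n m (\<lambda>i. snd (\<omega> i))) - mean_rating m p)\<^sup>2
         - ((\<Sum>i=1..n. real (fst (\<omega> i))) / real n - mean_rating m p)\<^sup>2)"

definition params :: "real \<Rightarrow> nat \<Rightarrow> (nat pmf \<times> (nat \<Rightarrow> real)) set" where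
  "params q m = {(p, g). set_pmf p \<subseteq> {1..m} \<and> (\<forall>r\<in>{1..m}. g r \<in> {q..1})}"

text \<open>
  The regret is a polynomial in the finitely many numbers \<open>pmf p r\<close> and \<open>g r\<close>, which range over a
  compact set, so the supremum is a maximum.
\<close>

definition max_regret :: "real \<Rightarrow> nat \<Rightarrow> nat \<Rightarrow> aggregator \<Rightarrow> real" where
  "max_regret q n m f = (SUP (p, g) \<in> params q m. regret n m f p g)"

definition k1 :: "real \<Rightarrow> nat \<Rightarrow> (nat \<Rightarrow> real) \<Rightarrow> nat" where
  "k1 q m ph = Max {k \<in> {1..m}.
     (\<Sum>r\<in>{1..<k}. (real r - real k) * ph r) + q * (\<Sum>r\<in>{k<..m}. (real r - real k) * ph r) \<ge> 0}"

definition k2 :: "real \<Rightarrow> nat \<Rightarrow> (nat \<Rightarrow> real) \<Rightarrow> nat" where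
  "k2 q m ph = Max {k \<in> {1..m}.
     q * (\<Sum>r\<in>{1..<k}. (real r - real k) * ph r) + (\<Sum>r\<in>{k<..m}. (real r - real k) * ph r) \<ge> 0}"

definition lower_est :: "real \<Rightarrow> nat \<Rightarrow> (nat \<Rightarrow> real) \<Rightarrow> real" where
  "lower_est q m ph = (let k = k1 q m ph in
     ((\<Sum>r\<in>{1..k}. real r * ph r) + q * (\<Sum>r\<in>{k<..m}. real r * ph r))
     / ((\<Sum>r\<in>{1..k}. ph r) + q * (\<Sum>r\<in>{k<..m}. ph r)))"

definition upper_est :: "real \<Rightarrow> nat \<Rightarrow> (nat \<Rightarrow> real) \<Rightarrow> real" where
  "upper_est q m ph = (let k = k2 q m ph in
     (q * (\<Sum>r\<in>{1..k}. real r * ph r) + (\<Sum>r\<in>{k<..m}. real r * ph r))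
     / (q * (\<Sum>r\<in>{1..k}. ph r) + (\<Sum>r\<in>{k<..m}. ph r)))"

definition empirical :: "nat \<Rightarrow> (nat \<Rightarrow> nat) \<Rightarrow> nat \<Rightarrow> real" where
  "empirical m h r = real (h r) / real (\<Sum>j=1..m. h j)"

text \<open>\<open>c\<close> is the value returned when no rating is observed.\<close>

definition paa :: "real \<Rightarrow> nat \<Rightarrow> real \<Rightarrow> aggregator" where
  "paa q m c h =
     (if (\<Sum>j=1..m. h j) = 0 then c
      else (upper_est q m (empirical m h) + lower_est q m (empirical m h)) / 2)"

end

(*
Given the observed proportions, the means compatible with g in [q,1]^m are the averages of the ratings
reweighted by w_r = q/g_r in [q,1], and lower_est and upper_est are the extreme reweighted averages.
They differ by at most D = (m-1)(1-q)/(1+q), so the PAA is within D/2 of the reweighted empirical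
average for the true w. The latter is a ratio of two i.i.d. sums, whose numerator (centred at mu) and
denominator have standard deviations at most (m-1) sqrt n and sqrt n; hence the regret of the PAA is
at most D^2/4 + O(m^2 / sqrt n).

Conversely, two instances supported on the ratings 1 and m have the same law of observations while
their means differ by exactly D, so every aggregator has maximal regret at least D^2/4 - (m-1)^2/n.
*)
theory Submission
  imports Defs
begin

section \<open>Averages of the ratings under reweighted frequencies\<close>

text \<open>A common factor of \<open>w\<close> or of \<open>h\<close> cancels, so counts and
  proportions give the same value, and so do the weights \<open>1 / g r\<close>, which undo the
  selective reporting, and the weights \<open>q / g r\<close>, which stay in
  \<open>{q..1}\<close>.\<close>

definition wmean :: "nat \<Rightarrow> (nat \<Rightarrow> real) \<Rightarrow> (nat \<Rightarrow> real) \<Rightarrow> real" where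
  "wmean m w h = (\<Sum>r=1..m. real r * (w r * h r)) / (\<Sum>r=1..m. w r * h r)"

text \<open>Weighted deviations from the mean itself cancel. The identity turns a comparison of a
  ratio with \<open>x\<close> into the sign of a sum that is linear in \<open>w\<close>.\<close>

lemma wmean_deviation:
  assumes "(\<Sum>r=1..m. w r * h r) > 0"
  shows "(\<Sum>r=1..m. (real r - x) * (w r * h r)) = (wmean m w h - x) * (\<Sum>r=1..m. w r * h r)"
proof -
  have "(\<Sum>r=1..m. real r * (w r * h r)) = wmean m w h * (\<Sum>r=1..m. w r * h r)"
    using assms by (simp add: wmean_def)
  then show ?thesis
    by (simp add: left_diff_distrib sum_subtractf flip: sum_distrib_left)
qed

lemma le_wmean_iff:
  assumes "(\<Sum>r=1..m. w r * h r) > 0"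
  shows "x \<le> wmean m w h \<longleftrightarrow> 0 \<le> (\<Sum>r=1..m. (real r - x) * (w r * h r))"
  unfolding wmean_deviation[OF assms] using assms by (simp add: zero_le_mult_iff)

lemma wmean_le_iff:
  assumes "(\<Sum>r=1..m. w r * h r) > 0"
  shows "wmean m w h \<le> x \<longleftrightarrow> (\<Sum>r=1..m. (real r - x) * (w r * h r)) \<le> 0"
  unfolding wmean_deviation[OF assms] using assms by (simp add: mult_le_0_iff)

lemma sum_weights_pos:
  fixes w h :: "'a \<Rightarrow> real"
  assumes "finite I" "\<And>i. i \<in> I \<Longrightarrow> h i \<ge> 0" "sum h I > 0" "q > 0" "\<And>i. i \<in> I \<Longrightarrow> w i \<ge> q"
  shows "(\<Sum>i\<in>I. w i * h i) > 0"
proof -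
  have "0 < q * sum h I"
    using assms by simp
  also have "\<dots> \<le> (\<Sum>i\<in>I. w i * h i)"
    unfolding sum_distrib_left by (intro sum_mono mult_right_mono assms)
  finally show ?thesis .
qed

text \<open>
  The gap is at most the range of \<open>f\<close> times the total variation distance of the two reweightings,
  and for a set of relative mass \<open>a\<close> the latter is at most
  \<open>a / (a + q * b) - q * a / (q * a + b)\<close> with \<open>b = 1 - a\<close>, which is largest at \<open>a = b\<close>.
\<close>

lemma weighted_average_gap:
  fixes f v w h :: "'a \<Rightarrow> real"
  assumes fin: "finite I" and h: "\<And>i. i \<in> I \<Longrightarrow> h i \<ge> 0" and pos: "sum h I > 0"
    and q: "0 < q" "q \<le> 1"
    and v: "\<And>i. i \<in> I \<Longrightarrow> v i \<in> {q..1}" and w: "\<And>i. i \<in> I \<Longrightarrow> w i \<in> {q..1}"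
    and f: "\<And>i. i \<in> I \<Longrightarrow> f i \<in> {0..M}" and M: "M \<ge> 0"
  shows "(\<Sum>i\<in>I. f i * (v i * h i)) / (\<Sum>i\<in>I. v i * h i)
       - (\<Sum>i\<in>I. f i * (w i * h i)) / (\<Sum>i\<in>I. w i * h i) \<le> M * ((1 - q) / (1 + q))"
proof -
  define V where "V = (\<Sum>i\<in>I. v i * h i)"
  define W where "W = (\<Sum>i\<in>I. w i * h i)"
  have V: "V > 0" and W: "W > 0"
    unfolding V_def W_def using fin h pos q v w by (auto intro!: sum_weights_pos[where q = q])
  \<comment> \<open>On \<open>A\<close> the first normalised reweighting is at least the second, so
    \<open>A\<close> is a set where their total variation distance is attained.\<close>
  define A where "A = {i \<in> I. w i * h i / W \<le> v i * h i / V}"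
  define B where "B = I - A"
  have AB: "A \<subseteq> I" "B \<subseteq> I" "A \<union> B = I" "A \<inter> B = {}" and finAB: "finite A" "finite B"
    using fin by (auto simp: A_def B_def)
  note split = sum.union_disjoint[OF finAB AB(4), unfolded AB(3)]
  define a where "a = sum h A"
  define b where "b = sum h B"
  define vA where "vA = (\<Sum>i\<in>A. v i * h i)"
  define vB where "vB = (\<Sum>i\<in>B. v i * h i)"
  define wA where "wA = (\<Sum>i\<in>A. w i * h i)"
  define wB where "wB = (\<Sum>i\<in>B. w i * h i)"
  have ab: "a \<ge> 0" "b \<ge> 0" "a + b > 0"
    unfolding a_def b_def split[of h, symmetric] using AB h pos by (auto intro!: sum_nonneg)
  have up: "(\<Sum>i\<in>J. u i * h i) \<le> sum h J"
    and lo: "q * sum h J \<le> (\<Sum>i\<in>J. u i * h i)"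
    if "J \<subseteq> I" "\<And>i. i \<in> I \<Longrightarrow> u i \<in> {q..1}" for J u
  proof -
    show "(\<Sum>i\<in>J. u i * h i) \<le> sum h J"
      using that h by (intro sum_mono mult_left_le_one_le) (use q in force)+
    show "q * sum h J \<le> (\<Sum>i\<in>J. u i * h i)"
      unfolding sum_distrib_left using that h by (intro sum_mono mult_right_mono) auto
  qed
  have bounds: "vA \<le> a" "q * b \<le> vB" "q * a \<le> wA" "wB \<le> b"
    unfolding vA_def vB_def wA_def wB_def a_def b_def
    using up lo AB v w by auto
  have VAB: "V = vA + vB" and WAB: "W = wA + wB"
    unfolding V_def W_def vA_def vB_def wA_def wB_def by (rule split)+
  \<comment> \<open>Cross-multiplied form of the next bound: \<open>vA / (vA + vB)\<close> grows
    with \<open>vA\<close> and decreases in \<open>vB\<close>, so the extreme case is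
    \<open>vA = a\<close>, \<open>vB = q * b\<close>.\<close>
  have "vA * (q * b) \<le> a * vB"
    using bounds ab q by (intro mult_mono) auto
  moreover have pos1: "a + q * b > 0"
    using ab q by (cases "a = 0") (auto intro: add_pos_nonneg)
  moreover have pos2: "q * a + b > 0"
    using ab q by (cases "b = 0") (auto intro: add_nonneg_pos)
  ultimately have 1: "vA / V \<le> a / (a + q * b)"
    using V by (simp add: divide_simps VAB algebra_simps)
  have "q * a * wB \<le> wA * b"
  proof (intro mult_mono)
    show "wA \<ge> 0" using bounds(3) ab q by (meson mult_nonneg_nonneg less_imp_le order_trans)
    show "wB \<ge> 0" unfolding wB_def using AB h w q by (force intro!: sum_nonneg mult_nonneg_nonneg)
  qed (use bounds in auto)
  then have 2: "q * a / (q * a + b) \<le> wA / W"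
    using W pos2 by (simp add: divide_simps WAB algebra_simps)
  \<comment> \<open>The two sides of \<open>key\<close> differ by exactly this square, so equality
    holds at \<open>a = b\<close>.\<close>
  have "0 \<le> q * (a - b)\<^sup>2"
    using q by simp
  then have key: "(1 + q)\<^sup>2 * (a * b) \<le> (a + q * b) * (q * a + b)"
    by (simp add: power2_eq_square algebra_simps)
  have "a / (a + q * b) - q * a / (q * a + b) = (1 - q) * (1 + q) * (a * b) / ((a + q * b) * (q * a + b))"
    using pos1 pos2 by (simp add: field_simps)
  also have "\<dots> \<le> (1 - q) / (1 + q)"
  proof -
    have "(1 - q) * ((1 + q)\<^sup>2 * (a * b)) \<le> (1 - q) * ((a + q * b) * (q * a + b))"
      using key q by (intro mult_left_mono) auto
    then show ?thesis
      using pos1 pos2 q by (simp add: pos_divide_le_eq pos_le_divide_eq power2_eq_square mult_ac)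
  qed
  finally have 3: "vA / V - wA / W \<le> (1 - q) / (1 + q)"
    using 1 2 by linarith
  have "(\<Sum>i\<in>I. f i * (v i * h i)) / V - (\<Sum>i\<in>I. f i * (w i * h i)) / W
      = (\<Sum>i\<in>I. f i * (v i * h i / V - w i * h i / W))"
    by (simp add: sum_divide_distrib sum_subtractf right_diff_distrib)
  also have "\<dots> = (\<Sum>i\<in>A. f i * (v i * h i / V - w i * h i / W))
                + (\<Sum>i\<in>B. f i * (v i * h i / V - w i * h i / W))"
    by (rule split)
  \<comment> \<open>The difference of the normalised weights is nonnegative on \<open>A\<close> and
    nonpositive on \<open>B\<close>, so \<open>f\<close> is replaced by its upper bound
    \<open>M\<close> on \<open>A\<close> and by its lower bound \<open>0\<close> on
    \<open>B\<close>.\<close>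
  also have "\<dots> \<le> (\<Sum>i\<in>A. M * (v i * h i / V - w i * h i / W)) + 0"
  proof (intro add_mono sum_mono sum_nonpos mult_right_mono mult_nonneg_nonpos)
    fix i assume "i \<in> B"
    then show "v i * h i / V - w i * h i / W \<le> 0"
      by (auto simp: A_def B_def)
  qed (use f AB in \<open>auto simp: A_def\<close>)
  also have "\<dots> = M * (vA / V - wA / W)"
    by (simp add: vA_def wA_def sum_divide_distrib sum_subtractf sum_distrib_left right_diff_distrib)
  also have "\<dots> \<le> M * ((1 - q) / (1 + q))"
    using 3 M by (rule mult_left_mono)
  finally show ?thesis
    by (simp add: V_def W_def)
qed

text \<open>Subtracting 1 from every rating lowers both means by 1 and leaves values between 0 and
  \<open>m - 1\<close>, so \<open>weighted_average_gap\<close> applies with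
  \<open>M = m - 1\<close>.\<close>

lemma wmean_gap:
  assumes h: "\<And>r. h r \<ge> 0" and pos: "(\<Sum>r=1..m. h r) > 0" and q: "0 < q" "q \<le> 1" and m: "m \<ge> 1"
    and v: "\<And>r. r \<in> {1..m} \<Longrightarrow> v r \<in> {q..1}" and w: "\<And>r. r \<in> {1..m} \<Longrightarrow> w r \<in> {q..1}"
  shows "wmean m v h - wmean m w h \<le> (real m - 1) * ((1 - q) / (1 + q))"
proof -
  have shift: "(\<Sum>r=1..m. (real r - 1) * (u r * h r)) / (\<Sum>r=1..m. u r * h r) = wmean m u h - 1"
    if "\<And>r. r \<in> {1..m} \<Longrightarrow> u r \<in> {q..1}" for u
  proof -
    have "(\<Sum>r=1..m. u r * h r) > 0"
      using that h pos q by (intro sum_weights_pos[where q = q]) auto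
    then show ?thesis
      by (subst wmean_deviation) auto
  qed
  show ?thesis
    using weighted_average_gap[of "{1..m}" h q v w "\<lambda>r. real r - 1" "real m - 1"] assms
      shift[OF v] shift[OF w] by auto
qed

lemma wmean_bounds:
  assumes "\<And>r. h r \<ge> 0" "\<And>r. r \<in> {1..m} \<Longrightarrow> w r \<ge> 0" "(\<Sum>r=1..m. w r * h r) > 0"
  shows "wmean m w h \<in> {1..real m}"
  using assms by (auto simp: le_wmean_iff wmean_le_iff intro!: sum_nonneg sum_nonpos mult_nonpos_nonneg)

section \<open>Threshold weights and the extreme reweighted averages\<close>

text \<open>The term \<open>r = j\<close> vanishes, so the weight at \<open>j\<close> is free. Hence
  the weights that switch from \<open>a\<close> to \<open>b\<close> just after \<open>k\<close>
  serve both \<open>j = k\<close> and \<open>j = Suc k\<close>.\<close>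

lemma threshold_sum:
  fixes h w :: "nat \<Rightarrow> real"
  assumes "j \<in> {1..m}" "\<And>r. r < j \<Longrightarrow> w r = a" "\<And>r. r > j \<Longrightarrow> w r = b"
  shows "a * (\<Sum>r\<in>{1..<j}. (real r - real j) * h r) + b * (\<Sum>r\<in>{j<..m}. (real r - real j) * h r)
       = (\<Sum>r=1..m. (real r - real j) * (w r * h r))"
proof -
  have "{1..m} = {1..<j} \<union> ({j} \<union> {j<..m})"
    using assms(1) by auto
  then have "(\<Sum>r=1..m. (real r - real j) * (w r * h r))
      = (\<Sum>r\<in>{1..<j}. (real r - real j) * (w r * h r))
        + (\<Sum>r\<in>{j<..m}. (real r - real j) * (w r * h r))"
    by (simp, subst sum.union_disjoint) auto
  then show ?thesis
    using assms(2,3) by (simp add: sum_distrib_left mult_ac)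
qed

text \<open>The threshold is the floor of the weighted mean that it induces.\<close>

lemma threshold_brackets_wmean:
  fixes h :: "nat \<Rightarrow> real"
  assumes h: "\<And>r. h r \<ge> 0" and pos: "(\<Sum>r=1..m. h r) > 0" and ab: "a > 0" "b > 0" and m: "m \<ge> 1"
    and k_eq: "k = Max {k \<in> {1..m}. a * (\<Sum>r\<in>{1..<k}. (real r - real k) * h r)
                               + b * (\<Sum>r\<in>{k<..m}. (real r - real k) * h r) \<ge> 0}"
  defines "w \<equiv> \<lambda>r. if r \<le> k then a else b"
  shows "k \<in> {1..m}"
    and "\<And>r. r \<in> {1..m} \<Longrightarrow> r \<le> k \<Longrightarrow> real r \<le> wmean m w h"
    and "\<And>r. r \<in> {1..m} \<Longrightarrow> k < r \<Longrightarrow> wmean m w h \<le> real r"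
proof -
  let ?T = "\<lambda>k. a * (\<Sum>r\<in>{1..<k}. (real r - real k) * h r)
              + b * (\<Sum>r\<in>{k<..m}. (real r - real k) * h r)"
  define S where "S = {k \<in> {1..m}. ?T k \<ge> 0}"
  have k: "k = Max S"
    by (simp add: k_eq S_def)
  have "finite S"
    by (simp add: S_def)
  \<comment> \<open>For \<open>k = 1\<close> the sum over smaller ratings is empty, so the set under
    \<open>Max\<close> is never empty.\<close>
  have "?T 1 \<ge> 0"
    using ab h by (auto intro!: mult_nonneg_nonneg sum_nonneg)
  then have "1 \<in> S"
    unfolding S_def using m by (intro CollectI conjI) auto
  then have "k \<in> S"
    unfolding k using \<open>finite S\<close> by (intro Max_in) auto
  then show km: "k \<in> {1..m}"
    by (simp add: S_def)
  have W: "(\<Sum>r=1..m. w r * h r) > 0"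
    using h pos ab by (intro sum_weights_pos[where q = "min a b"]) (auto simp: w_def)
  have "?T k \<ge> 0"
    using \<open>k \<in> S\<close> by (simp add: S_def)
  also have "?T k = (\<Sum>r=1..m. (real r - real k) * (w r * h r))"
    using km by (intro threshold_sum) (auto simp: w_def)
  finally have kL: "real k \<le> wmean m w h"
    using W by (simp add: le_wmean_iff)
  then show "real r \<le> wmean m w h" if "r \<in> {1..m}" "r \<le> k" for r
    using that by linarith
  show "wmean m w h \<le> real r" if r: "r \<in> {1..m}" "k < r" for r
  proof -
    \<comment> \<open>As \<open>r\<close> lies above \<open>k\<close> and at most at
      \<open>m\<close>, \<open>Suc k\<close> is an admissible threshold. By maximality of
      \<open>k\<close> its inequality must fail, which puts the mean at most at
      \<open>Suc k\<close>.\<close>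
    have "Suc k \<notin> S"
      using Max_ge[OF \<open>finite S\<close>, of "Suc k"] k by auto
    then have "?T (Suc k) < 0"
      using r by (auto simp: S_def)
    also have "?T (Suc k) = (\<Sum>r=1..m. (real r - real (Suc k)) * (w r * h r))"
      using r by (intro threshold_sum) (auto simp: w_def)
    finally have "wmean m w h \<le> real (Suc k)"
      using W by (simp add: wmean_le_iff)
    with r show ?thesis
      by linarith
  qed
qed

lemma sum_split_threshold:
  fixes h w :: "nat \<Rightarrow> real"
  assumes "k \<in> {1..m}"
  shows "a * (\<Sum>r\<in>{1..k}. h r) + b * (\<Sum>r\<in>{k<..m}. h r) = (\<Sum>r=1..m. (if r \<le> k then a else b) * h r)"
proof -
  have "{1..m} = {1..k} \<union> {k<..m}"
    using assms by auto
  then have "(\<Sum>r=1..m. (if r \<le> k then a else b) * h r)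
      = (\<Sum>r\<in>{1..k}. (if r \<le> k then a else b) * h r) + (\<Sum>r\<in>{k<..m}. (if r \<le> k then a else b) * h r)"
    by (simp add: sum.union_disjoint ivl_disj_int)
  then show ?thesis
    by (simp add: sum_distrib_left)
qed

text \<open>Centre the deviation sum at the mean \<open>l\<close> of the weights for
  \<open>k1\<close>. Ratings up to \<open>k1\<close> lie at or below \<open>l\<close> and carry the
  largest weight 1, the others lie at or above \<open>l\<close> and carry the smallest weight
  \<open>q\<close>. So each term is minimal among weights in \<open>{q..1}\<close>; the sum is 0 for
  these weights and hence nonnegative for any others. The upper estimate is the mirror
  image.\<close>

lemma
  fixes h :: "nat \<Rightarrow> real"
  assumes h: "\<And>r. h r \<ge> 0" and pos: "(\<Sum>r=1..m. h r) > 0" and q: "0 < q" "q \<le> 1" and m: "m \<ge> 1"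
  shows lower_est_eq_wmean: "lower_est q m h = wmean m (\<lambda>r. if r \<le> k1 q m h then 1 else q) h"
    and lower_est_le_wmean:
      "\<And>w. (\<And>r. r \<in> {1..m} \<Longrightarrow> w r \<in> {q..1}) \<Longrightarrow> lower_est q m h \<le> wmean m w h"
    and upper_est_eq_wmean: "upper_est q m h = wmean m (\<lambda>r. if r \<le> k2 q m h then q else 1) h"
    and wmean_le_upper_est:
      "\<And>w. (\<And>r. r \<in> {1..m} \<Longrightarrow> w r \<in> {q..1}) \<Longrightarrow> wmean m w h \<le> upper_est q m h"
proof -
  have k1: "k1 q m h = Max {k \<in> {1..m}. 1 * (\<Sum>r\<in>{1..<k}. (real r - real k) * h r)
                                       + q * (\<Sum>r\<in>{k<..m}. (real r - real k) * h r) \<ge> 0}"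
    by (simp add: k1_def)
  have k2: "k2 q m h = Max {k \<in> {1..m}. q * (\<Sum>r\<in>{1..<k}. (real r - real k) * h r)
                                       + 1 * (\<Sum>r\<in>{k<..m}. (real r - real k) * h r) \<ge> 0}"
    by (simp add: k2_def)
  note L = threshold_brackets_wmean[OF h pos _ _ m k1]
  note U = threshold_brackets_wmean[OF h pos _ _ m k2]
  have W: "(\<Sum>r=1..m. w r * h r) > 0" if "\<And>r. r \<in> {1..m} \<Longrightarrow> w r \<ge> q" for w
    using h pos q that by (intro sum_weights_pos[where q = q]) auto
  define wl where "wl = (\<lambda>r. if r \<le> k1 q m h then 1 else q)"
  define wu where "wu = (\<lambda>r. if r \<le> k2 q m h then q else 1)"
  have Wl: "(\<Sum>r=1..m. wl r * h r) > 0" and Wu: "(\<Sum>r=1..m. wu r * h r) > 0"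
    using q W[of wl] W[of wu] by (simp_all add: wl_def wu_def)
  show le: "lower_est q m h = wmean m (\<lambda>r. if r \<le> k1 q m h then 1 else q) h"
    using sum_split_threshold[OF L(1), of 1 h q] sum_split_threshold[OF L(1), of 1 "\<lambda>r. real r * h r" q] q
    by (simp add: lower_est_def wmean_def Let_def mult_ac)
  show ue: "upper_est q m h = wmean m (\<lambda>r. if r \<le> k2 q m h then q else 1) h"
    using sum_split_threshold[OF U(1), of q h 1] sum_split_threshold[OF U(1), of q "\<lambda>r. real r * h r" 1] q
    by (simp add: upper_est_def wmean_def Let_def mult_ac)
  show "lower_est q m h \<le> wmean m w h" if w: "\<And>r. r \<in> {1..m} \<Longrightarrow> w r \<in> {q..1}" for w
  proof -
    define l where "l = wmean m wl h"
    have "0 = (\<Sum>r=1..m. (real r - l) * (wl r * h r))"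
      unfolding wmean_deviation[OF Wl] by (simp add: l_def)
    also have "\<dots> \<le> (\<Sum>r=1..m. (real r - l) * (w r * h r))"
    proof (rule sum_mono)
      fix r assume r: "r \<in> {1..m}"
      show "(real r - l) * (wl r * h r) \<le> (real r - l) * (w r * h r)"
      proof (cases "r \<le> k1 q m h")
        case True
        then show ?thesis
          using L(2)[OF _ _ r True] q h[of r] w[OF r]
          by (intro mult_left_mono_neg mult_right_mono) (auto simp: l_def wl_def)
      next
        case False
        then show ?thesis
          using L(3)[OF _ _ r] q h[of r] w[OF r]
          by (intro mult_left_mono mult_right_mono) (auto simp: l_def wl_def)
      qed
    qed
    finally show ?thesis
      using W[of w] w le by (subst le_wmean_iff) (auto simp: l_def wl_def)
  qed
  show "wmean m w h \<le> upper_est q m h" if w: "\<And>r. r \<in> {1..m} \<Longrightarrow> w r \<in> {q..1}" for w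
  proof -
    define u where "u = wmean m wu h"
    have "(\<Sum>r=1..m. (real r - u) * (w r * h r)) \<le> (\<Sum>r=1..m. (real r - u) * (wu r * h r))"
    proof (rule sum_mono)
      fix r assume r: "r \<in> {1..m}"
      show "(real r - u) * (w r * h r) \<le> (real r - u) * (wu r * h r)"
      proof (cases "r \<le> k2 q m h")
        case True
        then show ?thesis
          using U(2)[OF _ _ r True] q h[of r] w[OF r]
          by (intro mult_left_mono_neg mult_right_mono) (auto simp: u_def wu_def)
      next
        case False
        then show ?thesis
          using U(3)[OF _ _ r] q h[of r] w[OF r]
          by (intro mult_left_mono mult_right_mono) (auto simp: u_def wu_def)
      qed
    qed
    also have "\<dots> = 0"
      unfolding wmean_deviation[OF Wu] by (simp add: u_def)
    finally show ?thesis
      using W[of w] w ue by (subst wmean_le_iff) (auto simp: u_def wu_def)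
  qed
qed

text \<open>With \<open>w r = q / g r\<close>, the sum \<open>S\<close> is an inverse-probability estimate of \<open>q * n\<close>.\<close>

lemma paa_error:
  fixes h :: "nat \<Rightarrow> nat" and n :: nat
  assumes q: "0 < q" "q \<le> 1" and m: "m \<ge> 1" and c: "c \<in> {1..real m}" and \<mu>: "\<mu> \<in> {1..real m}"
    and w: "\<And>r. r \<in> {1..m} \<Longrightarrow> w r \<in> {q..1}" and n: "n > 0"
  defines "S \<equiv> (\<Sum>r=1..m. w r * real (h r))"
    and "X \<equiv> (\<Sum>r=1..m. (real r - \<mu>) * (w r * real (h r)))"
  shows "\<bar>paa q m c h - \<mu>\<bar> \<le> real m - 1"
    and "\<bar>paa q m c h - \<mu>\<bar> \<le> (real m - 1) * ((1 - q) / (1 + q)) / 2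
           + (\<bar>X\<bar> + (real m - 1) * \<bar>S - q * n\<bar>) / (q * n)"
proof -
  define M where "M = real m - 1"
  define d where "d = M * ((1 - q) / (1 + q))"
  have M: "M \<ge> 0" and d: "d \<ge> 0"
    using m q by (auto simp: M_def d_def)
  have qn: "q * n > 0"
    using q n by simp
  consider (none) "(\<Sum>j=1..m. h j) = 0" | (some) "(\<Sum>j=1..m. h j) > 0"
    by linarith
  then have "\<bar>paa q m c h - \<mu>\<bar> \<le> M \<and> \<bar>paa q m c h - \<mu>\<bar> \<le> d / 2 + (\<bar>X\<bar> + M * \<bar>S - q * n\<bar>) / (q * n)"
  proof cases
    case none
    \<comment> \<open>Without observations the term
      \<open>M * \<bar>S - q * n\<bar> / (q * n)\<close> equals \<open>M\<close>, which absorbs the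
      error of the default value \<open>c\<close>.\<close>
    then have "S = 0" "X = 0"
      by (auto simp: S_def X_def)
    moreover have "paa q m c h = c"
      using none by (simp add: paa_def)
    ultimately show ?thesis
      using c \<mu> d qn q n by (auto simp: M_def abs_if)
  next
    case some
    define H where "H = real (\<Sum>j=1..m. h j)"
    have H: "H > 0"
      using some by (simp only: H_def of_nat_0_less_iff)
    define e where "e = empirical m h"
    have e: "e r = real (h r) / H" for r
      by (simp add: e_def empirical_def H_def)
    have e0: "e r \<ge> 0" for r
      using H by (simp add: e)
    have "(\<Sum>r=1..m. e r) = 1"
      using H by (simp add: e H_def flip: sum_divide_distrib)
    then have e1: "(\<Sum>r=1..m. e r) > 0"
      by simp
    define l where "l = lower_est q m e"
    define u where "u = upper_est q m e"
    define y where "y = wmean m w e"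
    note est = lower_est_eq_wmean[OF e0 e1 q m] upper_est_eq_wmean[OF e0 e1 q m]
    have "l \<le> y" "y \<le> u"
      using lower_est_le_wmean[OF e0 e1 q m w] wmean_le_upper_est[OF e0 e1 q m w]
      by (auto simp: l_def u_def y_def)
    have "u - l \<le> d"
      unfolding u_def l_def d_def M_def est using e0 e1 q m by (intro wmean_gap) auto
    have in_range: "wmean m v e \<in> {1..real m}" if "\<And>r. r \<in> {1..m} \<Longrightarrow> v r \<in> {q..1}" for v
    proof (rule wmean_bounds)
      show "(\<Sum>r=1..m. v r * e r) > 0"
        using e0 e1 q that by (intro sum_weights_pos[where q = q]) auto
      show "v r \<ge> 0" if "r \<in> {1..m}" for r
        using \<open>\<And>r. r \<in> {1..m} \<Longrightarrow> v r \<in> {q..1}\<close>[OF that] q by simp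
    qed (rule e0)
    have "u \<in> {1..real m}" "l \<in> {1..real m}" "y \<in> {1..real m}"
      unfolding u_def l_def y_def est using q w by (auto intro!: in_range simp del: atLeastAtMost_iff)
        auto
    then have range: "\<bar>(u + l) / 2 - \<mu>\<bar> \<le> M" "\<bar>y - \<mu>\<bar> \<le> M"
      using \<mu> by (auto simp: M_def abs_if field_simps)
    have "S = H * (\<Sum>r=1..m. w r * e r)" and "X = H * (\<Sum>r=1..m. (real r - \<mu>) * (w r * e r))"
      using H by (simp_all add: S_def X_def e sum_distrib_left)
    moreover have We: "(\<Sum>r=1..m. w r * e r) > 0"
      using e0 e1 q w by (intro sum_weights_pos[where q = q]) auto
    ultimately have "X = (y - \<mu>) * S"
      unfolding wmean_deviation[OF We] by (simp add: y_def)
    \<comment> \<open>The random denominator \<open>S\<close> is traded for the constant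
      \<open>q * n\<close>; the correction costs at most \<open>M\<close> times the fluctuation of
      \<open>S\<close>.\<close>
    then have "(y - \<mu>) * (q * n) = X - (y - \<mu>) * (S - q * n)"
      by (simp add: algebra_simps)
    then have "\<bar>y - \<mu>\<bar> * (q * n) = \<bar>X - (y - \<mu>) * (S - q * n)\<bar>"
      using qn by (metis abs_mult abs_of_pos)
    also have "\<dots> \<le> \<bar>X\<bar> + \<bar>y - \<mu>\<bar> * \<bar>S - q * n\<bar>"
      by (metis abs_mult abs_triangle_ineq4)
    also have "\<dots> \<le> \<bar>X\<bar> + M * \<bar>S - q * n\<bar>"
      using range by (intro add_left_mono mult_right_mono) auto
    finally have "\<bar>y - \<mu>\<bar> \<le> (\<bar>X\<bar> + M * \<bar>S - q * n\<bar>) / (q * n)"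
      using qn by (simp add: pos_le_divide_eq)
    \<comment> \<open>The midpoint of an interval of length at most \<open>d\<close> is within
      \<open>d / 2\<close> of each of its points.\<close>
    moreover have "\<bar>(u + l) / 2 - y\<bar> \<le> d / 2"
      using \<open>l \<le> y\<close> \<open>y \<le> u\<close> \<open>u - l \<le> d\<close> by (simp add: abs_le_iff field_simps)
    moreover have "paa q m c h = (u + l) / 2"
      using some unfolding paa_def u_def l_def e_def by (subst if_not_P) linarith+
    ultimately show ?thesis
      using range by linarith
  qed
  then show "\<bar>paa q m c h - \<mu>\<bar> \<le> real m - 1"
    and "\<bar>paa q m c h - \<mu>\<bar> \<le> (real m - 1) * ((1 - q) / (1 + q)) / 2
           + (\<bar>X\<bar> + (real m - 1) * \<bar>S - q * n\<bar>) / (q * n)"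
    by (auto simp: M_def d_def)
qed

section \<open>Expectations and second moments over rater samples\<close>

lemma two_point_sum:
  fixes F :: "nat \<Rightarrow> real"
  assumes "m \<ge> 2" "\<And>r. r \<in> {1..m} \<Longrightarrow> r \<noteq> 1 \<Longrightarrow> r \<noteq> m \<Longrightarrow> F r = 0"
  shows "(\<Sum>r=1..m. F r) = F 1 + F m"
proof -
  have "(\<Sum>r=1..m. F r) = (\<Sum>r\<in>{1, m}. F r)"
    using assms by (intro sum.mono_neutral_right) auto
  then show ?thesis
    using assms by simp
qed

text \<open>Condition on the true rating \<open>x\<close>, which is reported with probability
  \<open>g x\<close>. The range of \<open>g\<close> matters because \<open>bernoulli_pmf\<close>
  clamps its parameter to the unit interval.\<close>

lemma expectation_rater_pmf:
  fixes \<phi> :: "nat \<times> nat \<Rightarrow> real"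
  assumes "finite A" "set_pmf p \<subseteq> A" "\<And>x. x \<in> A \<Longrightarrow> g x \<in> {0..1}"
  shows "measure_pmf.expectation (rater_pmf p g) \<phi>
       = (\<Sum>x\<in>A. pmf p x * (\<phi> (x, x) * g x + \<phi> (x, 0) * (1 - g x)))"
  unfolding rater_pmf_def using assms
  by (simp add: pmf_expectation_bind[where A = A] bind_return_pmf flip: map_pmf_def cong: sum.cong)

lemma set_rater_pmf: "set_pmf (rater_pmf p g) \<subseteq> set_pmf p \<times> insert 0 (set_pmf p)"
  by (auto simp: rater_pmf_def split: if_splits)

lemma finite_set_rater_pmf: "finite (set_pmf p) \<Longrightarrow> finite (set_pmf (rater_pmf p g))"
  by (rule finite_subset[OF set_rater_pmf]) auto

lemma finite_set_Pi_pmf: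
  assumes "finite A" "\<And>i. i \<in> A \<Longrightarrow> finite (set_pmf (P i))"
  shows "finite (set_pmf (Pi_pmf A d P))"
  using assms by (simp add: set_Pi_pmf finite_PiE_dflt)

text \<open>Independent centred terms are orthogonal, so their second moments add. The induction
  splits off one coordinate; the cross term vanishes because \<open>\<phi>\<close> has mean
  0.\<close>

lemma expectation_square_sum_Pi_pmf:
  fixes \<phi> :: "'a \<Rightarrow> real"
  assumes "finite A" and P: "finite (set_pmf P)" and mean: "measure_pmf.expectation P \<phi> = 0"
  shows "measure_pmf.expectation (Pi_pmf A d (\<lambda>_. P)) (\<lambda>\<omega>. (\<Sum>i\<in>A. \<phi> (\<omega> i))\<^sup>2)
       = card A * measure_pmf.expectation P (\<lambda>x. (\<phi> x)\<^sup>2)"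
  using assms(1)
proof (induction A rule: finite_induct)
  case empty
  then show ?case by simp
next
  case (insert a A)
  let ?Q = "Pi_pmf A d (\<lambda>_. P)"
  let ?s = "\<lambda>\<omega>. \<Sum>i\<in>A. \<phi> (\<omega> i)"
  have fin: "finite (set_pmf ?Q)"
    using insert.hyps P by (intro finite_set_Pi_pmf)
  note int = integrable_measure_pmf_finite[OF fin] integrable_measure_pmf_finite[OF P]
  have upd: "(\<Sum>i\<in>A. \<phi> (if i = a then x else \<omega> i)) = ?s \<omega>" for x \<omega>
    using insert.hyps by (intro sum.cong) auto
  have "measure_pmf.expectation (Pi_pmf (insert a A) d (\<lambda>_. P)) (\<lambda>\<omega>. (\<Sum>i\<in>insert a A. \<phi> (\<omega> i))\<^sup>2)
      = (\<Sum>x\<in>set_pmf P. pmf P x * measure_pmf.expectation ?Q (\<lambda>\<omega>. (\<phi> x + ?s \<omega>)\<^sup>2))"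
    using insert.hyps P fin
    by (simp add: Pi_pmf_insert' pmf_expectation_bind[where A = "set_pmf P"] upd flip: map_pmf_def)
  also have "\<dots> = measure_pmf.expectation P (\<lambda>x. measure_pmf.expectation ?Q (\<lambda>\<omega>. (\<phi> x + ?s \<omega>)\<^sup>2))"
    using P by (subst integral_measure_pmf[of "set_pmf P"]) auto
  also have "\<dots> = measure_pmf.expectation P
      (\<lambda>x. (\<phi> x)\<^sup>2 + measure_pmf.expectation ?Q (\<lambda>\<omega>. (?s \<omega>)\<^sup>2) + 2 * \<phi> x * measure_pmf.expectation ?Q ?s)"
    by (simp add: power2_sum int)
  also have "\<dots> = measure_pmf.expectation P (\<lambda>x. (\<phi> x)\<^sup>2) + measure_pmf.expectation ?Q (\<lambda>\<omega>. (?s \<omega>)\<^sup>2)"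
    using mean by (simp add: int)
  finally show ?case
    using insert by (simp add: algebra_simps)
qed

lemma finite_set_sample_pmf: "finite (set_pmf p) \<Longrightarrow> finite (set_pmf (sample_pmf n p g))"
  unfolding sample_pmf_def by (intro finite_set_Pi_pmf finite_set_rater_pmf) auto

lemma set_sample_pmf:
  assumes "\<omega> \<in> set_pmf (sample_pmf n p g)" "i \<in> {1..n}"
  shows "fst (\<omega> i) \<in> set_pmf p" "snd (\<omega> i) \<in> insert 0 (set_pmf p)"
proof -
  have "\<omega> i \<in> set_pmf (rater_pmf p g)"
    using assms by (auto simp: sample_pmf_def set_Pi_pmf PiE_dflt_def)
  then have "\<omega> i \<in> set_pmf p \<times> insert 0 (set_pmf p)"
    using set_rater_pmf by (rule subsetD[rotated])
  then show "fst (\<omega> i) \<in> set_pmf p" "snd (\<omega> i) \<in> insert 0 (set_pmf p)"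
    unfolding mem_Times_iff by simp_all
qed

lemma pmf_expectation_mono:
  fixes F G :: "'a \<Rightarrow> real"
  assumes "finite (set_pmf P)" "\<And>x. x \<in> set_pmf P \<Longrightarrow> F x \<le> G x"
  shows "measure_pmf.expectation P F \<le> measure_pmf.expectation P G"
  using assms by (intro integral_mono_AE integrable_measure_pmf_finite) (auto simp: AE_measure_pmf_iff)

lemma pmf_expectation_le:
  fixes F :: "'a \<Rightarrow> real"
  assumes "finite (set_pmf P)" "\<And>x. x \<in> set_pmf P \<Longrightarrow> F x \<le> b"
  shows "measure_pmf.expectation P F \<le> b"
  using pmf_expectation_mono[OF assms] by simp

text \<open>Serves three centred sums: the numerator and the denominator of the reweighted average,
  and the sum of the true ratings.\<close>

lemma expectation_square_sample_sum_le:
  fixes \<phi> :: "nat \<times> nat \<Rightarrow> real"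
  assumes p: "finite (set_pmf p)" and "measure_pmf.expectation (rater_pmf p g) \<phi> = 0"
    and B: "\<And>z. z \<in> set_pmf (rater_pmf p g) \<Longrightarrow> \<bar>\<phi> z\<bar> \<le> B"
  shows "measure_pmf.expectation (sample_pmf n p g) (\<lambda>\<omega>. (\<Sum>i=1..n. \<phi> (\<omega> i))\<^sup>2) \<le> n * B\<^sup>2"
proof -
  have "measure_pmf.expectation (rater_pmf p g) (\<lambda>x. (\<phi> x)\<^sup>2) \<le> B\<^sup>2"
    using power_mono[OF B abs_ge_zero, of _ 2] by (intro pmf_expectation_le finite_set_rater_pmf p) simp
  then show ?thesis
    using assms finite_set_rater_pmf[OF p]
    by (simp add: sample_pmf_def expectation_square_sum_Pi_pmf mult_left_mono)
qed

text \<open>Cauchy-Schwarz, in the form that the variance of \<open>\<bar>F x\<bar>\<close> is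
  nonnegative.\<close>

lemma expectation_abs_le_sqrt:
  fixes F :: "'a \<Rightarrow> real"
  assumes P: "finite (set_pmf P)" and "measure_pmf.expectation P (\<lambda>x. (F x)\<^sup>2) \<le> b"
  shows "measure_pmf.expectation P (\<lambda>x. \<bar>F x\<bar>) \<le> sqrt b"
proof (rule real_le_rsqrt)
  note int = integrable_measure_pmf_finite[OF P]
  have "0 \<le> measure_pmf.variance P (\<lambda>x. \<bar>F x\<bar>)"
    by simp
  also have "\<dots> = measure_pmf.expectation P (\<lambda>x. (F x)\<^sup>2) - (measure_pmf.expectation P (\<lambda>x. \<bar>F x\<bar>))\<^sup>2"
    by (subst measure_pmf.variance_eq) (simp_all add: int)
  finally show "(measure_pmf.expectation P (\<lambda>x. \<bar>F x\<bar>))\<^sup>2 \<le> b"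
    using assms(2) by simp
qed

section \<open>Histograms, admissible parameters and boundedness of the regret\<close>

text \<open>Group the raters by reported value; \<open>\<psi> 0 = 0\<close> removes the unobserved
  raters, whom the histogram does not count. This turns linear functions of the histogram into sums
  over independent raters.\<close>

lemma sum_histogram:
  fixes \<psi> :: "nat \<Rightarrow> real"
  assumes "\<And>i. i \<in> {1..n} \<Longrightarrow> y i \<in> {0..m}" "\<psi> 0 = 0"
  shows "(\<Sum>i=1..n. \<psi> (y i)) = (\<Sum>r=1..m. \<psi> r * real (histogram n m y r))"
proof -
  have "(\<Sum>i=1..n. \<psi> (y i)) = (\<Sum>r=0..m. \<Sum>i\<in>{i \<in> {1..n}. y i = r}. \<psi> (y i))"
    using assms(1) by (intro sum.group[symmetric]) auto
  also have "\<dots> = (\<Sum>r=0..m. \<psi> r * card {i \<in> {1..n}. y i = r})"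
    by (intro sum.cong) (auto simp: mult.commute)
  also have "\<dots> = (\<Sum>r=1..m. \<psi> r * card {i \<in> {1..n}. y i = r})"
    using assms(2) by (intro sum.mono_neutral_right) (auto simp: not_less_eq_eq)
  finally show ?thesis
    by (simp add: histogram_def)
qed

lemma finite_range_histogram: "finite (range (histogram n m))"
proof (rule finite_subset)
  show "range (histogram n m) \<subseteq> {h. \<forall>r. (r \<in> {1..m} \<longrightarrow> h r \<in> {0..n}) \<and> (r \<notin> {1..m} \<longrightarrow> h r = 0)}"
  proof clarify
    fix y :: "nat \<Rightarrow> nat" and r
    have "card {i \<in> {1..n}. y i = r} \<le> card {1..n}"
      by (intro card_mono) auto
    then show "(r \<in> {1..m} \<longrightarrow> histogram n m y r \<in> {0..n}) \<and> (r \<notin> {1..m} \<longrightarrow> histogram n m y r = 0)"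
      by (simp add: histogram_def)
  qed
qed (rule finite_set_of_finite_funs; simp)

lemma params_finite_support: "(p, g) \<in> params q m \<Longrightarrow> finite (set_pmf p)"
  by (auto simp: params_def intro: finite_subset[OF _ finite_atLeastAtMost])

lemma sum_pmf_support: "set_pmf p \<subseteq> {1..m::nat} \<Longrightarrow> (\<Sum>r=1..m. pmf p r) = 1"
  by (intro sum_pmf_eq_1) auto

lemma mean_rating_bounds:
  assumes "set_pmf p \<subseteq> {1..m}"
  shows "mean_rating m p \<in> {1..real m}"
proof -
  have "(\<Sum>r=1..m. 1 * pmf p r) \<le> mean_rating m p" "mean_rating m p \<le> (\<Sum>r=1..m. real m * pmf p r)"
    unfolding mean_rating_def by (intro sum_mono mult_right_mono; simp)+
  then show ?thesis
    using sum_pmf_support[OF assms] by (simp flip: sum_distrib_left)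
qed

text \<open>The subtracted squared error of the sample mean is nonnegative.\<close>

lemma regret_le_square_error:
  assumes "(p, g) \<in> params q m"
  shows "regret n m f p g \<le> measure_pmf.expectation (sample_pmf n p g)
     (\<lambda>\<omega>. (f (histogram n m (\<lambda>i. snd (\<omega> i))) - mean_rating m p)\<^sup>2)"
  unfolding regret_def
  by (intro pmf_expectation_mono finite_set_sample_pmf params_finite_support[OF assms]) simp

text \<open>A real supremum dominates its members only if the set is bounded. An arbitrary
  aggregator takes finitely many values on histograms and \<open>mean_rating\<close> lies between 1
  and \<open>m\<close>, so the squared errors are uniformly bounded.\<close>

lemma bdd_above_regret: "bdd_above ((\<lambda>(p, g). regret n m f p g) ` params q m)"
proof -
  define B where "B = Max ((\<lambda>h. \<bar>f h\<bar>) ` range (histogram n m))"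
  have B: "\<bar>f (histogram n m y)\<bar> \<le> B" for y
    unfolding B_def using finite_range_histogram by (intro Max_ge) auto
  have "regret n m f p g \<le> (B + real m)\<^sup>2" if pg: "(p, g) \<in> params q m" for p g
  proof (rule order_trans[OF regret_le_square_error[OF pg] pmf_expectation_le])
    fix \<omega>
    have "\<bar>f (histogram n m (\<lambda>i. snd (\<omega> i))) - mean_rating m p\<bar> \<le> B + real m"
      using B[of "\<lambda>i. snd (\<omega> i)"] mean_rating_bounds[of p m] pg by (auto simp: params_def)
    then show "(f (histogram n m (\<lambda>i. snd (\<omega> i))) - mean_rating m p)\<^sup>2 \<le> (B + real m)\<^sup>2"
      by (metis abs_ge_zero order_trans power2_abs power_mono)
  qed (intro finite_set_sample_pmf params_finite_support[OF pg])
  then show ?thesis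
    by (auto intro!: bdd_aboveI)
qed

lemma regret_le_max_regret: "(p, g) \<in> params q m \<Longrightarrow> regret n m f p g \<le> max_regret q n m f"
  unfolding max_regret_def by (rule cSUP_upper2[OF bdd_above_regret]) auto

section \<open>Upper bound for the regret of the aggregator\<close>

text \<open>The square of half the gap is the unavoidable bias. The rest comes from the sampling
  errors \<open>X\<close> and \<open>Z\<close>, whose absolute values have expectations at most
  \<open>M * sqrt n\<close> and \<open>sqrt n\<close>.\<close>

lemma regret_paa_le:
  assumes q: "0 < q" "q \<le> 1" and m: "m \<ge> 1" and c: "c \<in> {1..real m}" and n: "n > 0"
    and pg: "(p, g) \<in> params q m"
  shows "regret n m (paa q m c) p g
       \<le> ((real m - 1) * ((1 - q) / (1 + q)) / 2)\<^sup>2 + 4 * (real m - 1)\<^sup>2 / (q * sqrt n)"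
proof -
  define M where "M = real m - 1"
  define d where "d = M * ((1 - q) / (1 + q)) / 2"
  define \<mu> where "\<mu> = mean_rating m p"
  \<comment> \<open>These weights turn the reporting probability \<open>g r\<close> into the
    constant \<open>q\<close>, which makes both \<open>X\<close> and \<open>Z\<close>
    centred.\<close>
  define w where "w = (\<lambda>r. q / g r)"
  define P where "P = sample_pmf n p g"
  define H where "H = (\<lambda>\<omega>::nat \<Rightarrow> nat \<times> nat. histogram n m (\<lambda>i. snd (\<omega> i)))"
  define e where "e = (\<lambda>\<omega>. paa q m c (H \<omega>) - \<mu>)"
  define X where "X = (\<lambda>\<omega>. \<Sum>r=1..m. (real r - \<mu>) * (w r * real (H \<omega> r)))"
  define Z where "Z = (\<lambda>\<omega>. (\<Sum>r=1..m. w r * real (H \<omega> r)) - q * n)"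
  have supp: "set_pmf p \<subseteq> {1..m}" and g: "\<And>r. r \<in> {1..m} \<Longrightarrow> g r \<in> {q..1}"
    using pg by (auto simp: params_def)
  have g01: "g r \<in> {0..1}" and gpos: "g r > 0" and w: "w r \<in> {q..1}" if "r \<in> {1..m}" for r
    using g[OF that] q by (auto simp: w_def divide_simps mult_left_le)
  have \<mu>: "\<mu> \<in> {1..real m}"
    unfolding \<mu>_def by (rule mean_rating_bounds[OF supp])
  have p: "finite (set_pmf p)"
    by (rule params_finite_support[OF pg])
  have P: "finite (set_pmf P)"
    unfolding P_def by (rule finite_set_sample_pmf[OF p])
  note int = integrable_measure_pmf_finite[OF P]
  have M: "M \<ge> 0" and d: "0 \<le> d" "d \<le> M"
  proof -
    show "M \<ge> 0" using m by (simp add: M_def)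
    then show "0 \<le> d" using q by (simp add: d_def)
    have "(1 - q) / (1 + q) / 2 \<le> 1"
      using q by (simp add: field_simps)
    then have "M * ((1 - q) / (1 + q) / 2) \<le> M * 1"
      using \<open>M \<ge> 0\<close> by (rule mult_left_mono)
    then show "d \<le> M" by (simp add: d_def)
  qed
  have y_range: "snd (\<omega> i) \<in> {0..m}" if "\<omega> \<in> set_pmf P" "i \<in> {1..n}" for \<omega> i
    using set_sample_pmf(2)[of \<omega> n p g i] that supp by (auto simp: P_def)
  have raters: "fst z \<in> {1..m} \<and> (snd z = 0 \<or> snd z \<in> {1..m})" if "z \<in> set_pmf (rater_pmf p g)" for z
    using subsetD[OF set_rater_pmf that] supp unfolding mem_Times_iff by auto
  \<comment> \<open>Contributions of a single report. The value at 0 is set separately: an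
    unobserved rater contributes nothing, whereas \<open>(real 0 - \<mu>) * w 0\<close> need not
    vanish.\<close>
  define \<eta> where "\<eta> = (\<lambda>r::nat. if r = 0 then 0 else (real r - \<mu>) * w r)"
  define \<zeta> where "\<zeta> = (\<lambda>r::nat. if r = 0 then 0 else w r)"
  have X_eq: "X \<omega> = (\<Sum>i=1..n. \<eta> (snd (\<omega> i)))" if "\<omega> \<in> set_pmf P" for \<omega>
    using sum_histogram[of n "\<lambda>i. snd (\<omega> i)" m \<eta>] y_range[OF that]
    by (simp add: X_def H_def \<eta>_def mult.assoc)
  have Z_eq: "Z \<omega> = (\<Sum>i=1..n. \<zeta> (snd (\<omega> i)) - q)" if "\<omega> \<in> set_pmf P" for \<omega>
    using sum_histogram[of n "\<lambda>i. snd (\<omega> i)" m \<zeta>] y_range[OF that]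
    by (simp add: Z_def H_def \<zeta>_def sum_subtractf mult.commute)
  have EX: "measure_pmf.expectation P (\<lambda>\<omega>. (X \<omega>)\<^sup>2) \<le> n * M\<^sup>2"
  proof -
    have "measure_pmf.expectation (rater_pmf p g) (\<lambda>z. \<eta> (snd z)) = (\<Sum>r=1..m. q * ((real r - \<mu>) * pmf p r))"
      using g01 supp gpos
      by (subst expectation_rater_pmf[where A = "{1..m}"])
        (auto intro!: sum.cong simp: \<eta>_def w_def less_imp_neq[THEN not_sym])
    also have "\<dots> = q * (mean_rating m p - \<mu> * (\<Sum>r=1..m. pmf p r))"
      by (simp add: mean_rating_def left_diff_distrib sum_subtractf flip: sum_distrib_left)
    also have "\<dots> = 0"
      using sum_pmf_support[OF supp] by (simp add: \<mu>_def)
    finally have 0: "measure_pmf.expectation (rater_pmf p g) (\<lambda>z. \<eta> (snd z)) = 0" .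
    have "\<bar>\<eta> r\<bar> \<le> M" if "r = 0 \<or> r \<in> {1..m}" for r
    proof (cases "r = 0")
      case False
      then have r: "r \<in> {1..m}" using that by simp
      have "\<bar>\<eta> r\<bar> = \<bar>real r - \<mu>\<bar> * w r"
        using False w[OF r] q by (simp add: \<eta>_def abs_mult)
      also have "\<dots> \<le> M * 1"
        using w[OF r] r \<mu> M q by (intro mult_mono) (auto simp: M_def)
      finally show ?thesis by simp
    qed (use M in \<open>simp add: \<eta>_def\<close>)
    then have "measure_pmf.expectation P (\<lambda>\<omega>. (\<Sum>i=1..n. \<eta> (snd (\<omega> i)))\<^sup>2) \<le> n * M\<^sup>2"
      unfolding P_def using raters by (intro expectation_square_sample_sum_le p 0) blast
    moreover have "measure_pmf.expectation P (\<lambda>\<omega>. (X \<omega>)\<^sup>2)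
        \<le> measure_pmf.expectation P (\<lambda>\<omega>. (\<Sum>i=1..n. \<eta> (snd (\<omega> i)))\<^sup>2)"
      by (intro pmf_expectation_mono P) (simp add: X_eq)
    ultimately show ?thesis by simp
  qed
  have EZ: "measure_pmf.expectation P (\<lambda>\<omega>. (Z \<omega>)\<^sup>2) \<le> real n * 1\<^sup>2"
  proof -
    have "measure_pmf.expectation (rater_pmf p g) (\<lambda>z. \<zeta> (snd z)) = (\<Sum>r=1..m. q * pmf p r)"
      using g01 supp gpos
      by (subst expectation_rater_pmf[where A = "{1..m}"])
        (auto intro!: sum.cong simp: \<zeta>_def w_def less_imp_neq[THEN not_sym])
    also have "\<dots> = q"
      using sum_pmf_support[OF supp] by (simp flip: sum_distrib_left)
    finally have 0: "measure_pmf.expectation (rater_pmf p g) (\<lambda>z. \<zeta> (snd z) - q) = 0"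
      by (subst Bochner_Integration.integral_diff)
        (simp_all add: integrable_measure_pmf_finite finite_set_rater_pmf p)
    have "\<bar>\<zeta> r - q\<bar> \<le> 1" if "r = 0 \<or> r \<in> {1..m}" for r
      using that w[of r] q by (cases "r = 0") (auto simp: \<zeta>_def)
    then have "measure_pmf.expectation P (\<lambda>\<omega>. (\<Sum>i=1..n. \<zeta> (snd (\<omega> i)) - q)\<^sup>2) \<le> real n * 1\<^sup>2"
      unfolding P_def using raters by (intro expectation_square_sample_sum_le p 0) blast
    moreover have "measure_pmf.expectation P (\<lambda>\<omega>. (Z \<omega>)\<^sup>2)
        \<le> measure_pmf.expectation P (\<lambda>\<omega>. (\<Sum>i=1..n. \<zeta> (snd (\<omega> i)) - q)\<^sup>2)"
      by (intro pmf_expectation_mono P) (simp add: Z_eq)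
    ultimately show ?thesis by simp
  qed
  have EabsX: "measure_pmf.expectation P (\<lambda>\<omega>. \<bar>X \<omega>\<bar>) \<le> M * sqrt n"
    using expectation_abs_le_sqrt[OF P EX] M by (simp add: real_sqrt_mult mult.commute)
  have EabsZ: "measure_pmf.expectation P (\<lambda>\<omega>. \<bar>Z \<omega>\<bar>) \<le> sqrt n"
    using expectation_abs_le_sqrt[OF P EZ] by simp
  have pointwise: "(e \<omega>)\<^sup>2 \<le> d\<^sup>2 + 2 * M / (q * n) * (\<bar>X \<omega>\<bar> + M * \<bar>Z \<omega>\<bar>)" for \<omega>
  proof -
    define t where "t = (\<bar>X \<omega>\<bar> + M * \<bar>Z \<omega>\<bar>) / (q * n)"
    have t: "t \<ge> 0"
      using M q by (simp add: t_def)
    have le: "\<bar>e \<omega>\<bar> \<le> M" "\<bar>e \<omega>\<bar> \<le> d + t"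
      unfolding e_def t_def X_def Z_def d_def M_def
      using paa_error[where h = "H \<omega>" and w = w, OF q m c \<mu> _ n] w by blast+
    \<comment> \<open>Factoring the difference of squares keeps the bound linear in
      \<open>t\<close>, since the second factor is at most \<open>2 * M\<close>. Thus first absolute
      moments of \<open>X\<close> and \<open>Z\<close> suffice.\<close>
    have "(\<bar>e \<omega>\<bar> - d) * (\<bar>e \<omega>\<bar> + d) \<le> t * (\<bar>e \<omega>\<bar> + d)"
      using le d by (intro mult_right_mono) auto
    also have "\<dots> \<le> t * (2 * M)"
      using le d t by (intro mult_left_mono) auto
    finally have "(\<bar>e \<omega>\<bar> - d) * (\<bar>e \<omega>\<bar> + d) \<le> t * (2 * M)" .
    then have "(e \<omega>)\<^sup>2 \<le> d\<^sup>2 + 2 * M * t"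
      by (simp add: algebra_simps power2_eq_square abs_mult_self_eq)
    then show ?thesis
      by (simp add: t_def)
  qed
  have "regret n m (paa q m c) p g \<le> measure_pmf.expectation P (\<lambda>\<omega>. (e \<omega>)\<^sup>2)"
    using regret_le_square_error[OF pg] by (simp add: P_def e_def H_def \<mu>_def)
  also have "\<dots> \<le> measure_pmf.expectation P (\<lambda>\<omega>. d\<^sup>2 + 2 * M / (q * n) * (\<bar>X \<omega>\<bar> + M * \<bar>Z \<omega>\<bar>))"
    by (intro pmf_expectation_mono P pointwise)
  also have "\<dots> = d\<^sup>2 + 2 * M / (q * n) * (measure_pmf.expectation P (\<lambda>\<omega>. \<bar>X \<omega>\<bar>)
      + M * measure_pmf.expectation P (\<lambda>\<omega>. \<bar>Z \<omega>\<bar>))"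
    by (simp add: int)
  also have "\<dots> \<le> d\<^sup>2 + 2 * M / (q * n) * (M * sqrt n + M * sqrt n)"
    using EabsX EabsZ M q by (intro add_left_mono mult_left_mono add_mono) auto
  also have "\<dots> = d\<^sup>2 + 4 * M\<^sup>2 / (q * sqrt n)"
  proof -
    have "real n = sqrt n * sqrt n"
      by simp
    then show ?thesis
      using n q by (simp add: field_simps power2_eq_square)
  qed
  finally show ?thesis
    by (simp add: d_def M_def)
qed

section \<open>Lower bound for every aggregator from two indistinguishable instances\<close>

text \<open>
  The two worst instances put masses \<open>1 / (1 + q)\<close> and \<open>q / (1 + q)\<close> on the two extreme ratings and
  suppress the heavier one, so that each extreme rating is observed with probability \<open>q / (1 + q)\<close>.
\<close>

definition extreme_pmf :: "nat \<Rightarrow> real \<Rightarrow> nat pmf" where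
  "extreme_pmf m t = map_pmf (\<lambda>b. if b then m else 1) (bernoulli_pmf t)"

lemma set_extreme_pmf: "set_pmf (extreme_pmf m t) \<subseteq> {1, m}"
  by (auto simp: extreme_pmf_def)

lemma pmf_extreme_pmf:
  assumes "m \<ge> 2" "t \<in> {0..1}"
  shows "pmf (extreme_pmf m t) 1 = 1 - t" "pmf (extreme_pmf m t) m = t"
proof -
  have "(\<lambda>b. if b then m else 1) -` {1} = {False}" "(\<lambda>b. if b then m else 1) -` {m} = {True}"
    using assms by (auto split: if_splits)
  then show "pmf (extreme_pmf m t) 1 = 1 - t" "pmf (extreme_pmf m t) m = t"
    using assms by (simp_all add: extreme_pmf_def pmf_map measure_pmf_single)
qed

lemma mean_rating_extreme_pmf:
  assumes "m \<ge> 2" "t \<in> {0..1}"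
  shows "mean_rating m (extreme_pmf m t) = 1 + t * (real m - 1)"
proof -
  have "pmf (extreme_pmf m t) r = 0" if "r \<noteq> 1" "r \<noteq> m" for r
    using set_extreme_pmf[of m t] that by (auto simp: pmf_eq_0_set_pmf)
  then have "mean_rating m (extreme_pmf m t)
      = real 1 * pmf (extreme_pmf m t) 1 + real m * pmf (extreme_pmf m t) m"
    unfolding mean_rating_def using assms by (intro two_point_sum) auto
  then show ?thesis
    by (simp only: pmf_extreme_pmf[OF assms]) (simp add: algebra_simps)
qed

text \<open>The subtracted term is the variance of the mean of \<open>n\<close> independent ratings,
  each at distance at most \<open>m - 1\<close> from its expectation.\<close>

lemma regret_ge_square_error:
  assumes pg: "(p, g) \<in> params q m" and q: "0 \<le> q" and n: "n > 0"
  shows "regret n m f p g \<ge> measure_pmf.expectation (sample_pmf n p g)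
     (\<lambda>\<omega>. (f (histogram n m (\<lambda>i. snd (\<omega> i))) - mean_rating m p)\<^sup>2) - (real m - 1)\<^sup>2 / n"
proof -
  let ?\<mu> = "mean_rating m p"
  have supp: "set_pmf p \<subseteq> {1..m}" and g: "\<And>r. r \<in> {1..m} \<Longrightarrow> g r \<in> {0..1}"
    using pg order_trans[OF q] by (auto simp: params_def)
  have p: "finite (set_pmf p)"
    by (rule params_finite_support[OF pg])
  note int = integrable_measure_pmf_finite[OF finite_set_sample_pmf[OF p]]
  have "measure_pmf.expectation (rater_pmf p g) (\<lambda>z. real (fst z) - ?\<mu>)
      = (\<Sum>r=1..m. real r * pmf p r - ?\<mu> * pmf p r)"
    using g supp
    by (subst expectation_rater_pmf[where A = "{1..m}"])
      (auto intro!: sum.cong simp: left_diff_distrib right_diff_distrib)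
  also have "\<dots> = (\<Sum>r=1..m. real r * pmf p r) - ?\<mu> * (\<Sum>r=1..m. pmf p r)"
    by (simp add: sum_subtractf sum_distrib_left)
  also have "\<dots> = 0"
    using sum_pmf_support[OF supp] by (simp add: mean_rating_def)
  finally have 0: "measure_pmf.expectation (rater_pmf p g) (\<lambda>z. real (fst z) - ?\<mu>) = 0" .
  have bound: "\<bar>real (fst z) - ?\<mu>\<bar> \<le> real m - 1" if "z \<in> set_pmf (rater_pmf p g)" for z
  proof -
    have "fst z \<in> {1..m}"
      using subsetD[OF set_rater_pmf that] supp unfolding mem_Times_iff by auto
    then show ?thesis
      using mean_rating_bounds[OF supp] by auto
  qed
  have "((\<Sum>i=1..n. real (fst (\<omega> i))) / n - ?\<mu>)\<^sup>2 = (\<Sum>i=1..n. real (fst (\<omega> i)) - ?\<mu>)\<^sup>2 / (real n)\<^sup>2"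
    for \<omega> :: "nat \<Rightarrow> nat \<times> nat"
  proof -
    have "(\<Sum>i=1..n. real (fst (\<omega> i))) / n - ?\<mu> = (\<Sum>i=1..n. real (fst (\<omega> i)) - ?\<mu>) / n"
      using n by (simp add: sum_subtractf diff_divide_distrib)
    then show ?thesis
      by (simp only: power_divide)
  qed
  then have "measure_pmf.expectation (sample_pmf n p g)
      (\<lambda>\<omega>. ((\<Sum>i=1..n. real (fst (\<omega> i))) / n - ?\<mu>)\<^sup>2)
    = measure_pmf.expectation (sample_pmf n p g) (\<lambda>\<omega>. (\<Sum>i=1..n. real (fst (\<omega> i)) - ?\<mu>)\<^sup>2) / (real n)\<^sup>2"
    by simp
  also have "\<dots> \<le> n * (real m - 1)\<^sup>2 / (real n)\<^sup>2"
    using expectation_square_sample_sum_le[OF p 0 bound] by (intro divide_right_mono) auto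
  also have "\<dots> = (real m - 1)\<^sup>2 / n"
    using n by (simp add: power2_eq_square)
  finally show ?thesis
    unfolding regret_def by (subst Bochner_Integration.integral_diff) (auto simp: int)
qed

text \<open>Le Cam's two-point method: the observations have the same law \<open>Q\<close> under
  both instances, so \<open>f\<close> cannot be close to both means, and the maximal regret is at
  least the average of the two regrets.\<close>

lemma max_regret_ge:
  assumes q: "0 < q" "q \<le> 1" and m: "m \<ge> 2" and n: "n > 0"
  shows "((real m - 1) * ((1 - q) / (1 + q)) / 2)\<^sup>2 - (real m - 1)\<^sup>2 / n \<le> max_regret q n m f"
proof -
  define s where "s = q / (1 + q)"
  define t where "t = 1 / (1 + q)"
  \<comment> \<open>\<open>q * t = s\<close> makes the laws of the reports agree;
    \<open>t - s\<close> times \<open>m - 1\<close> is the distance of the two means and equals the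
    bound in \<open>wmean_gap\<close>.\<close>
  have st: "s \<in> {0..1}" "t \<in> {0..1}" "1 - s = t" "1 - t = s" "q * t = s" "t - s = (1 - q) / (1 + q)"
    using q by (auto simp: s_def t_def field_simps)
  define pL where "pL = extreme_pmf m s"
  define pH where "pH = extreme_pmf m t"
  define gL :: "nat \<Rightarrow> real" where "gL = (\<lambda>r. if r = 1 then q else 1)"
  define gH :: "nat \<Rightarrow> real" where "gH = (\<lambda>r. if r = m then q else 1)"
  have L: "(pL, gL) \<in> params q m" and H: "(pH, gH) \<in> params q m"
    using q m set_extreme_pmf[of m s] set_extreme_pmf[of m t]
    by (auto simp: params_def pL_def pH_def gL_def gH_def)
  \<comment> \<open>Under both instances a report is 1 or \<open>m\<close> with probability
    \<open>s\<close> each, and 0 otherwise.\<close>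
  have rater: "map_pmf snd (rater_pmf pL gL) = map_pmf snd (rater_pmf pH gH)"
  proof (rule pmf_eqI)
    fix y :: nat
    have pmf_snd: "pmf (map_pmf snd (rater_pmf p g)) y
        = pmf p 1 * (of_bool (1 = y) * g 1 + of_bool (0 = y) * (1 - g 1))
        + pmf p m * (of_bool (m = y) * g m + of_bool (0 = y) * (1 - g m))"
      if "set_pmf p \<subseteq> {1, m}" "g 1 \<in> {0..1}" "g m \<in> {0..1}" for p g
    proof -
      have "pmf (map_pmf snd (rater_pmf p g)) y
          = measure_pmf.expectation (rater_pmf p g) (\<lambda>z. indicator {y} (snd z))"
        by (simp add: pmf_map measure_pmf.emeasure_eq_measure flip: indicator_vimage)
      also have "\<dots> = (\<Sum>x\<in>{1, m}. pmf p x * (indicator {y} x * g x + indicator {y} 0 * (1 - g x)))"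
        using that by (subst expectation_rater_pmf[where A = "{1, m}"]) auto
      finally show ?thesis
        using m by (simp add: indicator_def of_bool_def)
    qed
    show "pmf (map_pmf snd (rater_pmf pL gL)) y = pmf (map_pmf snd (rater_pmf pH gH)) y"
    proof -
      have "pmf pL 1 = t" "pmf pL m = s" "pmf pH 1 = s" "pmf pH m = t"
        using st(1-4) m by (simp_all only: pL_def pH_def pmf_extreme_pmf)
      moreover have "gL 1 = q" "gL m = 1" "gH 1 = 1" "gH m = q"
        using m by (simp_all add: gL_def gH_def)
      moreover have "set_pmf pL \<subseteq> {1, m}" "set_pmf pH \<subseteq> {1, m}"
        unfolding pL_def pH_def by (rule set_extreme_pmf)+
      ultimately show ?thesis
        using pmf_snd[of pL gL] pmf_snd[of pH gH] q st(5)[symmetric] by (simp add: algebra_simps)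
    qed
  qed
  \<comment> \<open>The default 0 is \<open>snd (0, 0)\<close>, as needed to push \<open>snd\<close>
    through the product measure.\<close>
  define Q where "Q = Pi_pmf {1..n} 0 (\<lambda>_. map_pmf snd (rater_pmf pL gL))"
  have obs: "map_pmf (\<lambda>\<omega> i. snd (\<omega> i)) (sample_pmf n p g) = Q"
    if "map_pmf snd (rater_pmf p g) = map_pmf snd (rater_pmf pL gL)" for p g
    unfolding Q_def sample_pmf_def that[symmetric] by (subst Pi_pmf_map[where dflt = "(0, 0)"]) (auto intro!: map_pmf_cong)
  have err: "measure_pmf.expectation (sample_pmf n p g) (\<lambda>\<omega>. (f (histogram n m (\<lambda>i. snd (\<omega> i))) - \<nu>)\<^sup>2)
      = measure_pmf.expectation Q (\<lambda>y. (f (histogram n m y) - \<nu>)\<^sup>2)"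
    if "map_pmf snd (rater_pmf p g) = map_pmf snd (rater_pmf pL gL)" for p g \<nu>
    by (simp flip: obs[OF that])
  have finQ: "finite (set_pmf Q)"
    unfolding Q_def using params_finite_support[OF L]
    by (intro finite_set_Pi_pmf) (auto simp: finite_set_rater_pmf)
  note int = integrable_measure_pmf_finite[OF finQ]
  define a where "a = mean_rating m pL"
  define b where "b = mean_rating m pH"
  have ab: "(b - a) / 2 = (real m - 1) * ((1 - q) / (1 + q)) / 2"
    unfolding a_def b_def pL_def pH_def
    using m st by (simp add: mean_rating_extreme_pmf flip: st(6)) (simp add: algebra_simps)
  have "measure_pmf.expectation Q (\<lambda>_. 2 * ((b - a) / 2)\<^sup>2)
      \<le> measure_pmf.expectation Q (\<lambda>y. (f (histogram n m y) - a)\<^sup>2 + (f (histogram n m y) - b)\<^sup>2)"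
  proof (intro pmf_expectation_mono finQ)
    fix y
    \<comment> \<open>Parallelogram identity: twice the sum of the two squared errors is this square
      plus \<open>(b - a)\<^sup>2\<close>.\<close>
    have "0 \<le> (2 * f (histogram n m y) - (a + b))\<^sup>2"
      by simp
    then show "2 * ((b - a) / 2)\<^sup>2 \<le> (f (histogram n m y) - a)\<^sup>2 + (f (histogram n m y) - b)\<^sup>2"
      by (simp add: power2_eq_square field_simps)
  qed
  also have "\<dots> = measure_pmf.expectation Q (\<lambda>y. (f (histogram n m y) - a)\<^sup>2)
      + measure_pmf.expectation Q (\<lambda>y. (f (histogram n m y) - b)\<^sup>2)"
    by (simp only: Bochner_Integration.integral_add int)
  also have "\<dots> \<le> (regret n m f pL gL + (real m - 1)\<^sup>2 / n) + (regret n m f pH gH + (real m - 1)\<^sup>2 / n)"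
    using regret_ge_square_error[OF L _ n, of f] regret_ge_square_error[OF H _ n, of f] q
    unfolding err[OF refl] err[OF rater[symmetric]] a_def b_def by simp
  also have "\<dots> \<le> 2 * max_regret q n m f + 2 * ((real m - 1)\<^sup>2 / n)"
    using regret_le_max_regret[OF L, of n f] regret_le_max_regret[OF H, of n f] by simp
  finally show ?thesis
    unfolding ab by simp
qed

section \<open>Comparison of the two bounds\<close>

theorem theorem4p4:
  fixes q :: real and m :: "nat \<Rightarrow> nat" and c :: "nat \<Rightarrow> real"
  assumes "0 < q" and "q \<le> 1"
    and "\<And>n. m n \<ge> 2"
    and "(\<lambda>n. real (m n)) \<in> o(\<lambda>n. (real n / ln (real n)) powr (1/4))"
    and "\<And>n. c n \<in> {1..real (m n)}"
  shows "\<exists>(C::real) (N::nat). \<forall>n\<ge>N. \<forall>f::aggregator.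
           max_regret q n (m n) (paa q (m n) (c n))
             \<le> max_regret q n (m n) f + C * (real (m n))\<^sup>2 * sqrt (ln (real n) / real n)"
proof (intro exI allI impI)
  fix n :: nat and f :: aggregator
  \<comment> \<open>From 3 on, \<open>n\<close> exceeds Euler's number, so the logarithm is at least
    1 and \<open>1 / sqrt n\<close> is within the claimed rate.\<close>
  assume n: "n \<ge> 3"
  define M where "M = real (m n) - 1"
  define d where "d = (M * ((1 - q) / (1 + q)) / 2)\<^sup>2"
  have m: "m n \<ge> 1" "m n \<ge> 2"
    using assms(3)[of n] by simp_all
  have M: "0 \<le> M" "M \<le> real (m n)"
    using m by (simp_all add: M_def)
  have ln: "1 \<le> ln (real n)"
    using n exp_le by (subst ln_ge_iff) auto
  have n1: "1 / real n \<le> 1 / sqrt n"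
    using n real_sqrt_le_mono[of n "(real n)\<^sup>2"] by (intro divide_left_mono) (auto simp: power2_eq_square)
  have rate: "1 / sqrt n \<le> sqrt (ln n / n)"
    using ln by (simp add: real_sqrt_divide divide_right_mono)
  \<comment> \<open>Bounding a real supremum through its members requires a nonempty set.\<close>
  have "params q (m n) \<noteq> {}"
  proof -
    have "(return_pmf 1, \<lambda>_. 1) \<in> params q (m n)"
      using assms(1,2) m by (auto simp: params_def)
    then show ?thesis by blast
  qed
  moreover have "regret n (m n) (paa q (m n) (c n)) p g \<le> d + 4 * M\<^sup>2 / (q * sqrt n)"
    if "(p, g) \<in> params q (m n)" for p g
    unfolding d_def M_def using assms(1,2,5) m n that by (intro regret_paa_le) simp_all
  ultimately have "max_regret q n (m n) (paa q (m n) (c n)) \<le> d + 4 * M\<^sup>2 / (q * sqrt n)"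
    unfolding max_regret_def by (intro cSUP_least) auto
  \<comment> \<open>The leading term \<open>d\<close> is common to both bounds. What remains gives
    the constant \<open>1 + 4 / q\<close>: the 1 pays for the variance of the sample mean,
    \<open>4 / q\<close> for the sampling error of the aggregator.\<close>
  also have "\<dots> = (d - M\<^sup>2 / n) + M\<^sup>2 * (1 / n) + 4 / q * M\<^sup>2 * (1 / sqrt n)"
    by simp
  also have "\<dots> \<le> max_regret q n (m n) f + M\<^sup>2 * (1 / sqrt n) + 4 / q * M\<^sup>2 * (1 / sqrt n)"
    using max_regret_ge[OF assms(1,2) m(2), of n f] n n1 assms(1)
    by (intro add_mono mult_left_mono) (auto simp: d_def M_def)
  also have "\<dots> = max_regret q n (m n) f + (1 + 4 / q) * M\<^sup>2 * (1 / sqrt n)"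
    by (simp add: algebra_simps)
  also have "\<dots> \<le> max_regret q n (m n) f + (1 + 4 / q) * (real (m n))\<^sup>2 * sqrt (ln n / n)"
    using rate M assms(1) by (intro add_left_mono mult_mono power_mono) auto
  finally show "max_regret q n (m n) (paa q (m n) (c n))
      \<le> max_regret q n (m n) f + (1 + 4 / q) * (real (m n))\<^sup>2 * sqrt (ln (real n) / real n)" .
qed

end
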